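(* Let $G$ be a torsion-free group with identity element $e$ and let $R$ be a unital $G$-graded ring. Furthermore, suppose that the $G$-grading on $R$ is non-degenerate and that $R_e$ is a domain. Consider the following assertions: (i) Every unit in $R$ is homogeneous; (ii) $R$ is reduced; (iii) $R$ is a domain; (iv) Every idempotent in $R$ is trivial. Then (i)$\Rightarrow$(ii)$\Rightarrow$(iii)$\Rightarrow$(iv). Moreover, (iii)$\Rightarrow$(ii).
   Context: Rings are associative, not necessarily commutative. A ring $R$ is $G$-graded if there is a collection $\{R_g\}_{g\in G}$ of additive subgroups of $R$ such that $R=\oplus_{g\in G}R_g$ and $R_gR_h\subseteq R_{gh}$ for all $g,h\in G$. A nonzero element of $R$ is homogeneous if it belongs to $R_g$ for some $g\in G$. The $G$-grading is non-degenerate if, for each $g\in G$ and each nonzero $r_g\in R_g$, we have $r_gR_{g^{-1}}\neq\{0\}$ and $R_{g^{-1}}r_g\neq\{0\}$. A domain is a nonzero (not necessarily commutative) ring in which the product of any two nonzero elements is nonzero. A ring is reduced if it has no nonzero nilpotent elements. An idempotent is trivial if it equals $0$ or $1_R$. *)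

theory Defs
  imports "HOL-Algebra.Algebra"
begin

definition torsion_free_group :: "('g, 'm) monoid_scheme \<Rightarrow> bool" where
  "torsion_free_group G \<longleftrightarrow> group G \<and>
     (\<forall>x\<in>carrier G. \<forall>n::nat. 0 < n \<longrightarrow> x [^]\<^bsub>G\<^esub> n = \<one>\<^bsub>G\<^esub> \<longrightarrow> x = \<one>\<^bsub>G\<^esub>)"

(* The locale ring already means an associative unital ring, possibly noncommutative.
   The internal direct sum is expressed by unique decomposition: each element of R is
   the sum of a unique finitely supported family (f g) with f g in A g.  The extensional
   product PiE makes f unique as a HOL function (it is undefined off carrier G). *)
locale graded_ring =
  R: ring R + G: group G
  for R :: "('r, 'n) ring_scheme" (structure)
    and G :: "('g, 'm) monoid_scheme" (structure) +
  fixes A :: "'g \<Rightarrow> 'r set"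
  assumes component_subgroup: "\<And>g. g \<in> carrier G \<Longrightarrow> additive_subgroup (A g) R"
    and component_mult:
      "\<And>g h r s. \<lbrakk>g \<in> carrier G; h \<in> carrier G; r \<in> A g; s \<in> A h\<rbrakk>
         \<Longrightarrow> r \<otimes>\<^bsub>R\<^esub> s \<in> A (g \<otimes>\<^bsub>G\<^esub> h)"
    and direct_sum:
      "\<And>r. r \<in> carrier R \<Longrightarrow>
         \<exists>!f. f \<in> (\<Pi>\<^sub>E g\<in>carrier G. A g) \<and>
              finite {g \<in> carrier G. f g \<noteq> \<zero>\<^bsub>R\<^esub>} \<and>
              r = (\<Oplus>\<^bsub>R\<^esub>g\<in>{g \<in> carrier G. f g \<noteq> \<zero>\<^bsub>R\<^esub>}. f g)"

definition homogeneous ::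
    "('r, 'n) ring_scheme \<Rightarrow> ('g, 'm) monoid_scheme \<Rightarrow> ('g \<Rightarrow> 'r set) \<Rightarrow> 'r \<Rightarrow> bool" where
  "homogeneous R G A r \<longleftrightarrow> r \<noteq> \<zero>\<^bsub>R\<^esub> \<and> (\<exists>g\<in>carrier G. r \<in> A g)"

definition nondegenerate_grading ::
    "('r, 'n) ring_scheme \<Rightarrow> ('g, 'm) monoid_scheme \<Rightarrow> ('g \<Rightarrow> 'r set) \<Rightarrow> bool" where
  "nondegenerate_grading R G A \<longleftrightarrow>
     (\<forall>g\<in>carrier G. \<forall>r\<in>A g. r \<noteq> \<zero>\<^bsub>R\<^esub> \<longrightarrow>
        (\<lambda>s. r \<otimes>\<^bsub>R\<^esub> s) ` A (inv\<^bsub>G\<^esub> g) \<noteq> {\<zero>\<^bsub>R\<^esub>} \<and>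
        (\<lambda>s. s \<otimes>\<^bsub>R\<^esub> r) ` A (inv\<^bsub>G\<^esub> g) \<noteq> {\<zero>\<^bsub>R\<^esub>})"

(* The library's locale domain is commutative, hence this noncommutative version.  It
   is only applied to R and to its subring A \<one>, so the ring axioms are not repeated. *)
definition nc_domain :: "('r, 'n) ring_scheme \<Rightarrow> bool" where
  "nc_domain R \<longleftrightarrow> carrier R \<noteq> {\<zero>\<^bsub>R\<^esub>} \<and>
     (\<forall>x\<in>carrier R. \<forall>y\<in>carrier R.
        x \<noteq> \<zero>\<^bsub>R\<^esub> \<longrightarrow> y \<noteq> \<zero>\<^bsub>R\<^esub> \<longrightarrow> x \<otimes>\<^bsub>R\<^esub> y \<noteq> \<zero>\<^bsub>R\<^esub>)"

definition reduced_ring :: "('r, 'n) ring_scheme \<Rightarrow> bool" where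
  "reduced_ring R \<longleftrightarrow>
     (\<forall>x\<in>carrier R. \<forall>n::nat. 0 < n \<longrightarrow> x [^]\<^bsub>R\<^esub> n = \<zero>\<^bsub>R\<^esub> \<longrightarrow> x = \<zero>\<^bsub>R\<^esub>)"

definition only_trivial_idempotents :: "('r, 'n) ring_scheme \<Rightarrow> bool" where
  "only_trivial_idempotents R \<longleftrightarrow>
     (\<forall>x\<in>carrier R. x \<otimes>\<^bsub>R\<^esub> x = x \<longrightarrow> x = \<zero>\<^bsub>R\<^esub> \<or> x = \<one>\<^bsub>R\<^esub>)"

end

theory Submission
  imports Defs
begin

text \<open>The hypotheses make every product of two nonzero homogeneous elements nonzero: if
\<open>r\<close> and \<open>s\<close> are homogeneous and nonzero, non-degeneracy gives homogeneous \<open>a\<close>, \<open>b\<close> of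
inverse degrees with \<open>a r\<close> and \<open>s b\<close> nonzero in the identity component, which is a domain,
so \<open>(a r)(s b) \<noteq> 0\<close>.  In particular the degrees that occur form a subgroup of \<open>G\<close>.

The deep implication is that a reduced \<open>R\<close> is a domain.  If \<open>x y = 0\<close> in a reduced ring, then
\<open>(y x)\<^sup>2 = 0\<close>, hence \<open>y x = 0\<close>, hence \<open>(x a y)\<^sup>2 = 0\<close> and so \<open>x a y = 0\<close> for all \<open>a\<close>.  It is
therefore enough that \<open>R\<close> is prime (\<open>prime_if_torsion_free\<close>).  Torsion-free groups need not have
unique products, but they have a two-sided substitute (\<open>ex_two_sided_unique_product\<close>): for finite
nonempty \<open>S\<close>, \<open>T\<close> there is a group element \<open>u\<close> such that some product \<open>s\<^sub>0 u t\<^sub>0\<close> equals no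
other \<open>s u t\<close>.  With \<open>S\<close>, \<open>T\<close> the supports of \<open>x\<close>, \<open>y\<close> and \<open>a\<close> nonzero of degree \<open>u\<close>, the component
of \<open>x a y\<close> of degree \<open>s\<^sub>0 u t\<^sub>0\<close> is a single product of nonzero homogeneous elements.

The element \<open>u\<close> is found as in Passman's treatment of prime group rings.  A coincidence
\<open>s u t = s\<^sub>0 u t\<^sub>0\<close> says that \<open>u\<close> conjugates \<open>p = s\<^sub>0\<inverse> s\<close> to \<open>q = t\<^sub>0 t\<inverse>\<close>.  The solutions \<open>u\<close> lie in
one coset of the centralizer of \<open>p\<close>.  If \<open>p\<close> has infinitely many conjugates, this coset
belongs to a subgroup of infinite index; finitely many of those do not cover a group
(\<open>neumann_coset_covering\<close>), so \<open>u\<close> can avoid them, even inside the finite-index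
subgroup that centralizes the relevant elements of the FC-centre.  If \<open>p\<close> lies in the FC-centre, the
coincidence thus reduces to \<open>p = q\<close>.  The FC-centre of a torsion-free group is abelian
(\<open>fc_center_commute\<close>), so finitely many of its elements can be ordered
(\<open>ex_submonoid_deciding_signs\<close>); taking \<open>s\<^sub>0\<close> and \<open>t\<^sub>0\<close> maximal excludes \<open>p = q \<noteq> 1\<close>.

If all units are homogeneous and \<open>x\<^sup>2 = 0\<close>, then \<open>r = 1 + x\<close> is a unit, so it is homogeneous.  When its
degree is \<open>e\<close>, \<open>x\<close> lies in the identity component and vanishes; otherwise
\<open>1 = 2 r - r\<^sup>2\<close> has no component of degree \<open>e\<close>, which is absurd.  The remaining implications are
elementary.\<close>

section \<open>Coset coverings and the FC-centre\<close>

lemma finite_image_if_factors: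
  assumes "finite (f ` D)" and "\<And>x y. x \<in> D \<Longrightarrow> y \<in> D \<Longrightarrow> f x = f y \<Longrightarrow> g x = g y"
  shows "finite (g ` D)"
proof -
  have "g ` D \<subseteq> (\<lambda>z. g (inv_into D f z)) ` (f ` D)"
  proof
    fix w assume "w \<in> g ` D"
    then obtain x where x: "x \<in> D" "w = g x" by blast
    then have "g (inv_into D f (f x)) = g x"
      by (intro assms(2)) (auto simp: inv_into_into f_inv_into_f)
    with x show "w \<in> (\<lambda>z. g (inv_into D f z)) ` (f ` D)" by force
  qed
  then show ?thesis using assms(1) finite_subset by blast
qed

lemma finite_total_preorder_greatest:
  assumes "finite S" "S \<noteq> {}"
    and "\<And>s t. s \<in> S \<Longrightarrow> t \<in> S \<Longrightarrow> r s t \<or> r t s"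
    and "\<And>s t u. s \<in> S \<Longrightarrow> t \<in> S \<Longrightarrow> u \<in> S \<Longrightarrow> r s t \<Longrightarrow> r t u \<Longrightarrow> r s u"
  shows "\<exists>m\<in>S. \<forall>s\<in>S. r s m"
  using assms
proof (induction S rule: finite_ne_induct)
  case (insert x F)
  obtain m where m: "m \<in> F" "\<forall>s\<in>F. r s m"
    using insert.IH insert.prems by blast
  show ?case
  proof (cases "r x m")
    case True
    then show ?thesis using m by auto
  next
    case False
    then have mx: "r m x" using insert.prems(1)[of x m] m(1) by blast
    have "r s x" if "s \<in> insert x F" for s
    proof (cases "s = x")
      case True
      then show ?thesis using insert.prems(1)[of x x] by blast
    next
      case False
      then show ?thesis using insert.prems(2)[of s m x] that m mx by blast
    qed
    then show ?thesis by blast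
  qed
qed blast

context group
begin

text \<open>B. H. Neumann's covering lemma.  Induction on the set of subgroups: if the cosets
covered the group, a coset of \<open>K\<close> outside the
family would be covered by cosets of the other subgroups, hence so is every translate of
it, and all cosets of \<open>K\<close> in the family can be replaced by cosets of the others.\<close>
lemma neumann_coset_covering:
  assumes "finite \<K>" and "\<And>K. K \<in> \<K> \<Longrightarrow> subgroup K G \<and> infinite (rcosets K)"
    and "finite F" "F \<subseteq> carrier G"
  shows "\<exists>x\<in>carrier G. \<forall>K\<in>\<K>. \<forall>f\<in>F. x \<notin> K #> f"
  using assms
proof (induction \<K> arbitrary: F rule: finite_induct)
  case empty
  then show ?case by auto
next
  case (insert K \<K>)
  have K: "subgroup K G" "infinite (rcosets K)" using insert.prems(1) by auto
  have "\<not> rcosets K \<subseteq> (\<lambda>f. K #> f) ` F"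
    using K(2) insert.prems(2) finite_subset by blast
  then obtain g where g: "g \<in> carrier G" "\<And>f. f \<in> F \<Longrightarrow> K #> g \<noteq> K #> f"
    unfolding RCOSETS_def by blast
  (* the missing coset K #> g is moved onto K #> f' by right multiplication with inv g \<otimes> f' *)
  define F' where "F' = F \<union> (\<lambda>(f, f'). f \<otimes> inv g \<otimes> f') ` (F \<times> F)"
  have F': "finite F'" "F' \<subseteq> carrier G"
    using insert.prems(2,3) g(1) by (auto simp: F'_def)
  obtain x where x: "x \<in> carrier G" "\<And>H f. H \<in> \<K> \<Longrightarrow> f \<in> F' \<Longrightarrow> x \<notin> H #> f"
    using insert.IH[OF _ F'] insert.prems(1) by (metis insertCI)
  show ?case
  proof (cases "\<exists>f'\<in>F. x \<in> K #> f'")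
    case False
    then show ?thesis using x by (auto simp: F'_def)
  next
    case True
    then obtain f' k where f': "f' \<in> F" "f' \<in> carrier G" "k \<in> K" "k \<in> carrier G" "x = k \<otimes> f'"
      using K(1) insert.prems(3) subgroup.subset by (fastforce simp: r_coset_def)
    have kg: "k \<otimes> g \<in> K #> g" using f'(3) by (auto simp: r_coset_def)
    have "k \<otimes> g \<notin> H #> f" if "H \<in> insert K \<K>" "f \<in> F" for H f
    proof (cases "H = K")
      case True
      then show ?thesis
        using kg g that K(1) insert.prems(3) by (metis repr_independence subsetD)
    next
      case False
      show ?thesis
      proof
        assume "k \<otimes> g \<in> H #> f"
        then obtain h where h: "h \<in> H" "k \<otimes> g = h \<otimes> f" by (auto simp: r_coset_def)
        have carr: "h \<in> carrier G" "f \<in> carrier G"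
          using h(1) that insert.prems(1,3) subgroup.subset by blast+
        have "x = (k \<otimes> g) \<otimes> inv g \<otimes> f'" using f' g(1) by (simp add: m_assoc)
        also have "\<dots> = h \<otimes> (f \<otimes> inv g \<otimes> f')" using h(2) carr f' g(1) by (simp add: m_assoc)
        finally have "x \<in> H #> (f \<otimes> inv g \<otimes> f')" using h(1) by (auto simp: r_coset_def)
        moreover have "f \<otimes> inv g \<otimes> f' \<in> F'" using that(2) f'(1) by (force simp: F'_def)
        ultimately show False using x(2) that(1) False by blast
      qed
    qed
    then show ?thesis using f'(4) g(1) by blast
  qed
qed

definition centralizer :: "'a set \<Rightarrow> 'a set" where
  "centralizer P = {u \<in> carrier G. \<forall>p\<in>P. p \<otimes> u = u \<otimes> p}"

definition fc_center :: "'a set" where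
  "fc_center = {p \<in> carrier G. finite ((\<lambda>u. inv u \<otimes> p \<otimes> u) ` carrier G)}"

lemma conj_eq_iff:
  assumes "p \<in> carrier G" "q \<in> carrier G" "u \<in> carrier G"
  shows "inv u \<otimes> p \<otimes> u = q \<longleftrightarrow> p \<otimes> u = u \<otimes> q"
  using assms by (metis inv_closed inv_solve_left m_assoc m_closed)

lemma subgroup_centralizer:
  assumes "P \<subseteq> carrier G"
  shows "subgroup (centralizer P) G"
proof (rule subgroupI)
  fix a assume a: "a \<in> centralizer P"
  have "p \<otimes> inv a = inv a \<otimes> p" if "p \<in> P" for p
  proof -
    have "p \<otimes> a = a \<otimes> p" "p \<in> carrier G" "a \<in> carrier G"
      using a that assms by (auto simp: centralizer_def)
    then show ?thesis by (metis inv_closed inv_solve_left inv_solve_right m_assoc m_closed)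
  qed
  then show "inv a \<in> centralizer P" using a by (auto simp: centralizer_def)
next
  have "\<one> \<in> centralizer P" using assms by (auto simp: centralizer_def)
  then show "centralizer P \<noteq> {}" by blast
next
  fix a b assume ab: "a \<in> centralizer P" "b \<in> centralizer P"
  have "p \<otimes> (a \<otimes> b) = a \<otimes> b \<otimes> p" if "p \<in> P" for p
  proof -
    have "p \<otimes> a = a \<otimes> p" "p \<otimes> b = b \<otimes> p" "p \<in> carrier G" "a \<in> carrier G" "b \<in> carrier G"
      using ab that assms by (auto simp: centralizer_def)
    then show ?thesis by (metis m_assoc)
  qed
  then show "a \<otimes> b \<in> centralizer P" using ab by (auto simp: centralizer_def)
qed (use assms in \<open>auto simp: centralizer_def\<close>)

lemma rcos_eq_iff:
  assumes "subgroup K G" "u \<in> carrier G" "v \<in> carrier G"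
  shows "K #> u = K #> v \<longleftrightarrow> v \<otimes> inv u \<in> K"
proof -
  have "v \<in> K #> u \<longleftrightarrow> v \<otimes> inv u \<in> K"
  proof
    assume "v \<in> K #> u"
    then obtain k where "k \<in> K" "v = k \<otimes> u" by (auto simp: r_coset_def)
    moreover have "k \<in> carrier G" using \<open>k \<in> K\<close> assms(1) subgroup.subset by blast
    ultimately show "v \<otimes> inv u \<in> K" using assms by (simp add: m_assoc)
  next
    assume "v \<otimes> inv u \<in> K"
    moreover have "v = v \<otimes> inv u \<otimes> u" using assms by (simp add: m_assoc)
    ultimately show "v \<in> K #> u" unfolding r_coset_def by blast
  qed
  then show ?thesis using assms by (metis repr_independence rcos_self)
qed

lemma conj_eq_conj_iff:
  assumes "p \<in> carrier G" "u \<in> carrier G" "v \<in> carrier G"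
  shows "inv u \<otimes> p \<otimes> u = inv v \<otimes> p \<otimes> v \<longleftrightarrow> p \<otimes> (v \<otimes> inv u) = v \<otimes> inv u \<otimes> p"
proof -
  have "inv u \<otimes> p \<otimes> u = inv v \<otimes> p \<otimes> v \<longleftrightarrow> p \<otimes> v = v \<otimes> (inv u \<otimes> p \<otimes> u)"
    using conj_eq_iff[of p "inv u \<otimes> p \<otimes> u" v] assms by auto
  also have "v \<otimes> (inv u \<otimes> p \<otimes> u) = (v \<otimes> inv u \<otimes> p) \<otimes> u"
    using assms by (simp add: m_assoc)
  also have "p \<otimes> v = (v \<otimes> inv u \<otimes> p) \<otimes> u \<longleftrightarrow> p \<otimes> v \<otimes> inv u = v \<otimes> inv u \<otimes> p"
    using assms by (metis inv_solve_right' m_closed inv_closed)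
  finally show ?thesis using assms by (simp add: m_assoc)
qed

text \<open>A coset of the centralizer is determined by how it conjugates the finitely many elements of
\<open>P\<close>, and each of them has finitely many conjugates.\<close>
lemma finite_rcosets_centralizer:
  assumes "finite P" "P \<subseteq> fc_center"
  shows "finite (rcosets (centralizer P))"
proof -
  have P: "P \<subseteq> carrier G" using assms(2) by (auto simp: fc_center_def)
  let ?\<phi> = "\<lambda>u. \<lambda>p\<in>P. inv u \<otimes> p \<otimes> u"
  have "?\<phi> ` carrier G \<subseteq> (\<Pi>\<^sub>E p\<in>P. (\<lambda>u. inv u \<otimes> p \<otimes> u) ` carrier G)" by auto
  moreover have "finite (\<Pi>\<^sub>E p\<in>P. (\<lambda>u. inv u \<otimes> p \<otimes> u) ` carrier G)"
    using assms by (intro finite_PiE) (auto simp: fc_center_def)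
  ultimately have fin: "finite (?\<phi> ` carrier G)" by (rule finite_subset)
  have "centralizer P #> u = centralizer P #> v"
    if uv: "u \<in> carrier G" "v \<in> carrier G" "?\<phi> u = ?\<phi> v" for u v
  proof -
    have "inv u \<otimes> p \<otimes> u = inv v \<otimes> p \<otimes> v" if "p \<in> P" for p
      using fun_cong[OF uv(3), of p] that by simp
    then have "v \<otimes> inv u \<in> centralizer P"
      using uv P conj_eq_conj_iff by (auto simp: centralizer_def subset_iff)
    then show ?thesis using rcos_eq_iff[OF subgroup_centralizer[OF P]] uv by blast
  qed
  from finite_image_if_factors[OF fin this]
  show ?thesis by (simp add: RCOSETS_def UNION_singleton_eq_range)
qed

lemma infinite_rcosets_centralizer:
  assumes "p \<in> carrier G" "p \<notin> fc_center"
  shows "infinite (rcosets (centralizer {p}))"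
proof
  assume "finite (rcosets (centralizer {p}))"
  then have fin: "finite ((\<lambda>u. centralizer {p} #> u) ` carrier G)"
    by (simp add: RCOSETS_def UNION_singleton_eq_range)
  have "finite ((\<lambda>u. inv u \<otimes> p \<otimes> u) ` carrier G)"
  proof (rule finite_image_if_factors[OF fin])
    fix u v assume uv: "u \<in> carrier G" "v \<in> carrier G" "centralizer {p} #> u = centralizer {p} #> v"
    then have "v \<otimes> inv u \<in> centralizer {p}"
      using rcos_eq_iff[OF subgroup_centralizer] assms(1) by blast
    then show "inv u \<otimes> p \<otimes> u = inv v \<otimes> p \<otimes> v"
      using conj_eq_conj_iff uv assms(1) by (auto simp: centralizer_def)
  qed
  then show False using assms by (simp add: fc_center_def)
qed

lemma subgroup_fc_center: "subgroup fc_center G"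
proof (rule subgroupI)
  have "(\<lambda>u. inv u \<otimes> \<one> \<otimes> u) ` carrier G \<subseteq> {\<one>}" by auto
  then have "\<one> \<in> fc_center" using finite_subset by (auto simp: fc_center_def)
  then show "fc_center \<noteq> {}" by blast
next
  fix a assume a: "a \<in> fc_center"
  have "(\<lambda>u. inv u \<otimes> inv a \<otimes> u) ` carrier G = (\<lambda>x. inv x) ` (\<lambda>u. inv u \<otimes> a \<otimes> u) ` carrier G"
    using a by (force simp: fc_center_def image_image inv_mult_group m_assoc)
  then show "inv a \<in> fc_center" using a by (simp add: fc_center_def)
next
  fix a b assume ab: "a \<in> fc_center" "b \<in> fc_center"
  let ?c = "\<lambda>a. (\<lambda>u. inv u \<otimes> a \<otimes> u) ` carrier G"
  have "?c (a \<otimes> b) \<subseteq> (\<lambda>(x, y). x \<otimes> y) ` (?c a \<times> ?c b)"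
  proof
    fix x assume "x \<in> ?c (a \<otimes> b)"
    then obtain u where u: "u \<in> carrier G" "x = inv u \<otimes> (a \<otimes> b) \<otimes> u" by blast
    moreover have "u \<otimes> (inv u \<otimes> (b \<otimes> u)) = b \<otimes> u"
      using u(1) ab by (simp add: fc_center_def m_assoc[symmetric])
    ultimately have "x = (inv u \<otimes> a \<otimes> u) \<otimes> (inv u \<otimes> b \<otimes> u)"
      using ab by (simp add: fc_center_def m_assoc)
    then show "x \<in> (\<lambda>(x, y). x \<otimes> y) ` (?c a \<times> ?c b)" using u(1) by force
  qed
  then show "a \<otimes> b \<in> fc_center"
    using ab finite_subset[of "?c (a \<otimes> b)"] by (auto simp: fc_center_def)
qed (auto simp: fc_center_def)

end

section \<open>The FC-centre of a torsion-free group is abelian\<close>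

lemma torsion_free_group_subgroup:
  assumes "torsion_free_group G" "subgroup H G"
  shows "torsion_free_group (G\<lparr>carrier := H\<rparr>)"
proof -
  interpret group G using assms(1) by (simp add: torsion_free_group_def)
  show ?thesis
    unfolding torsion_free_group_def
  proof (intro conjI ballI allI impI)
    show "group (G\<lparr>carrier := H\<rparr>)" by (rule subgroup_imp_group[OF assms(2)])
    fix x and n :: nat
    assume "x \<in> carrier (G\<lparr>carrier := H\<rparr>)" "0 < n"
      "x [^]\<^bsub>G\<lparr>carrier := H\<rparr>\<^esub> n = \<one>\<^bsub>G\<lparr>carrier := H\<rparr>\<^esub>"
    then show "x = \<one>\<^bsub>G\<lparr>carrier := H\<rparr>\<^esub>"
      using assms subgroup.mem_carrier[OF assms(2)]
      by (simp add: torsion_free_group_def nat_pow_consistent[symmetric])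
  qed
qed

text \<open>The argument uses the transfer homomorphism \<open>V\<close> into the centre \<open>Z\<close>.  On \<open>Z\<close> it is the map
\<open>z \<mapsto> z\<^sup>n\<close>, where \<open>n\<close> is the index of \<open>Z\<close>.  Every element has a positive power in \<open>Z\<close>, so an element of the kernel of
\<open>V\<close> has finite order and is trivial.  Thus \<open>V\<close> embeds the group into the abelian group \<open>Z\<close>.\<close>
lemma (in group) torsion_free_center_by_finite_imp_comm:
  assumes tf: "torsion_free_group G"
    and fin: "finite (rcosets (centralizer (carrier G)))"
  shows "comm_group G"
proof -
  define Z where "Z = centralizer (carrier G)"
  have Zsub: "subgroup Z G" unfolding Z_def by (rule subgroup_centralizer) simp
  have Zcomm: "x \<otimes> z = z \<otimes> x" if "z \<in> Z" "x \<in> carrier G" for x z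
    using that by (auto simp: Z_def centralizer_def)
  have Zcarr: "z \<in> carrier G" if "z \<in> Z" for z using that by (auto simp: Z_def centralizer_def)
  interpret GZ: comm_group "G\<lparr>carrier := Z\<rparr>"
    using subgroup_imp_group[OF Zsub] Zcomm Zcarr
    by (intro group.group_comm_groupI) auto
  (* r selects a representative of each coset of Z; I is the resulting transversal *)
  define r where "r g = (SOME x. x \<in> Z #> g)" for g
  have r_mem: "r g \<in> Z #> g" if "g \<in> carrier G" for g
    unfolding r_def using rcos_self[OF that Zsub] by (rule someI)
  have r_carr: "r g \<in> carrier G" if "g \<in> carrier G" for g
    using r_mem[OF that] r_coset_subset_G[OF subgroup.subset[OF Zsub] that] by blast
  have coset_r: "Z #> r g = Z #> g" if "g \<in> carrier G" for g
    using repr_independence[OF r_mem[OF that] that Zsub] by simp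
  have r_eq_iff: "r g = r h \<longleftrightarrow> Z #> g = Z #> h" if "g \<in> carrier G" "h \<in> carrier G" for g h
    using coset_r that by (metis r_def)
  define I where "I = r ` carrier G"
  have I_carr: "t \<in> carrier G" if "t \<in> I" for t using that r_carr by (auto simp: I_def)
  have finI: "finite I"
    unfolding I_def
  proof (rule finite_image_if_factors)
    show "finite ((\<lambda>g. Z #> g) ` carrier G)"
      using fin by (simp add: Z_def RCOSETS_def UNION_singleton_eq_range)
  qed (use r_eq_iff in blast)
  have r_I: "r t = t" if "t \<in> I" for t
    using that coset_r r_eq_iff r_carr by (auto simp: I_def)
  have r_mult: "r (r x \<otimes> g) = r (x \<otimes> g)" if "x \<in> carrier G" "g \<in> carrier G" for x g
    using that coset_r r_eq_iff r_carr
    by (metis coset_mult_assoc m_closed subgroup.subset[OF Zsub])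
  have perm: "bij_betw (\<lambda>t. r (t \<otimes> g)) I I" if g: "g \<in> carrier G" for g
  proof -
    have "inj_on (\<lambda>t. r (t \<otimes> g)) I"
    proof (rule inj_on_inverseI)
      fix t assume t: "t \<in> I"
      have "r (r (t \<otimes> g) \<otimes> inv g) = r (t \<otimes> g \<otimes> inv g)"
        using r_mult I_carr t g by simp
      also have "\<dots> = t" using r_I I_carr t g by (simp add: m_assoc)
      finally show "r (r (t \<otimes> g) \<otimes> inv g) = t" .
    qed
    moreover have "(\<lambda>t. r (t \<otimes> g)) ` I \<subseteq> I" using g I_carr by (auto simp: I_def r_carr)
    ultimately show ?thesis using finI by (simp add: bij_betw_def endo_inj_surj)
  qed
  (* the factor in Z by which t \<otimes> g differs from its representative; it satisfies a cocycle identity *)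
  define c where "c t g = t \<otimes> g \<otimes> inv (r (t \<otimes> g))" for t g
  have c_Z: "c t g \<in> Z" if "t \<in> carrier G" "g \<in> carrier G" for t g
    unfolding c_def using rcos_eq_iff[OF Zsub] coset_r that r_carr by (metis m_closed)
  have cocycle: "c t (g \<otimes> h) = c t g \<otimes> c (r (t \<otimes> g)) h"
    if "t \<in> carrier G" "g \<in> carrier G" "h \<in> carrier G" for t g h
    unfolding c_def using that r_carr r_mult
    by (simp add: m_assoc inv_solve_left)
  define V where "V g = (\<Otimes>\<^bsub>G\<lparr>carrier := Z\<rparr>\<^esub>t\<in>I. c t g)" for g
  have cZ: "(\<lambda>t. c t g) \<in> I \<rightarrow> carrier (G\<lparr>carrier := Z\<rparr>)" if "g \<in> carrier G" for g
    using c_Z I_carr that by auto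
  have V_mult: "V (g \<otimes> h) = V g \<otimes> V h" if g: "g \<in> carrier G" and h: "h \<in> carrier G" for g h
  proof -
    have cz': "(\<lambda>t. c (r (t \<otimes> g)) h) \<in> I \<rightarrow> carrier (G\<lparr>carrier := Z\<rparr>)"
      using c_Z I_carr r_carr g h by auto
    have "V (g \<otimes> h) = (\<Otimes>\<^bsub>G\<lparr>carrier := Z\<rparr>\<^esub>t\<in>I. c t g \<otimes> c (r (t \<otimes> g)) h)"
      unfolding V_def using cZ[OF g] cz' cocycle I_carr g h c_Z r_carr
      by (intro GZ.finprod_cong') (auto intro: subgroup.m_closed[OF Zsub])
    also have "\<dots> = V g \<otimes> (\<Otimes>\<^bsub>G\<lparr>carrier := Z\<rparr>\<^esub>t\<in>I. c (r (t \<otimes> g)) h)"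
      unfolding V_def using GZ.finprod_multf[OF cZ[OF g] cz'] by simp
    also have "(\<Otimes>\<^bsub>G\<lparr>carrier := Z\<rparr>\<^esub>t\<in>I. c (r (t \<otimes> g)) h) = V h"
      unfolding V_def using GZ.finprod_reindex[of "\<lambda>t. c t h" "\<lambda>t. r (t \<otimes> g)" I]
        perm[OF g] cZ[OF h] by (simp add: bij_betw_def)
    finally show ?thesis .
  qed
  have V_Z: "V g \<in> Z" if "g \<in> carrier G" for g
    unfolding V_def using GZ.finprod_closed[OF cZ[OF that]] by simp
  interpret V: group_hom G "G\<lparr>carrier := Z\<rparr>" V
    by unfold_locales (auto simp: hom_def V_mult V_Z)
  have V_center: "V z = z [^] card I" if z: "z \<in> Z" for z
  proof -
    have "c t z = z" if t: "t \<in> I" for t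
    proof -
      have "z \<otimes> t \<otimes> inv t \<in> Z" using z t I_carr Zcarr by (simp add: m_assoc)
      then have "r (z \<otimes> t) = t"
        using r_eq_iff[of t "z \<otimes> t"] r_I[OF t] rcos_eq_iff[OF Zsub, of t "z \<otimes> t"] I_carr t Zcarr z by auto
      then show ?thesis
        unfolding c_def using Zcomm[OF z I_carr[OF t]] z t I_carr Zcarr by (simp add: m_assoc)
    qed
    then have "V z = (\<Otimes>\<^bsub>G\<lparr>carrier := Z\<rparr>\<^esub>t\<in>I. z)"
      unfolding V_def using z by (intro GZ.finprod_cong') auto
    also have "\<dots> = z [^]\<^bsub>G\<lparr>carrier := Z\<rparr>\<^esub> card I" using z by (intro GZ.finprod_const) simp
    finally show ?thesis by (simp add: nat_pow_consistent[symmetric])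
  qed
  have cardI: "0 < card I" using finI by (auto simp: card_gt_0_iff I_def)
  have torsion_free: "x = \<one>" if "x \<in> carrier G" "x [^] n = \<one>" "0 < n" for x and n :: nat
    using tf that by (auto simp: torsion_free_group_def)
  (* two powers of g lie in the same coset of Z, because there are finitely many cosets *)
  have power_Z: "\<exists>m>0. g [^] (m::nat) \<in> Z" if g: "g \<in> carrier G" for g
  proof -
    have "\<not> inj (\<lambda>n::nat. r (g [^] n))"
    proof
      assume "inj (\<lambda>n::nat. r (g [^] n))"
      moreover have "range (\<lambda>n::nat. r (g [^] n)) \<subseteq> I" using g by (auto simp: I_def)
      ultimately show False using finI by (meson finite_imageD finite_subset infinite_UNIV_nat)
    qed
    then obtain i j :: nat where "i \<noteq> j" "r (g [^] i) = r (g [^] j)" by (auto simp: inj_def)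
    then obtain i j :: nat where ij: "i < j" "r (g [^] i) = r (g [^] j)" by (metis nat_neq_iff)
    then have "g [^] j \<otimes> inv (g [^] i) \<in> Z"
      using rcos_eq_iff[OF Zsub] r_eq_iff g by (metis nat_pow_closed)
    moreover have "g [^] j = g [^] (j - i) \<otimes> g [^] i"
      using ij(1) g by (simp add: nat_pow_mult)
    ultimately have "g [^] (j - i) \<in> Z" using g by (simp add: m_assoc)
    then show ?thesis using ij(1) by (intro exI[of _ "j - i"]) simp
  qed
  have "kernel G (G\<lparr>carrier := Z\<rparr>) V = {\<one>}"
  proof -
    have "g = \<one>" if g: "g \<in> carrier G" "V g = \<one>" for g
    proof -
      obtain m :: nat where m: "m > 0" "g [^] m \<in> Z" using power_Z g(1) by blast
      have "(g [^] m) [^] card I = V (g [^] m)" using V_center m by simp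
      also have "\<dots> = V g [^]\<^bsub>G\<lparr>carrier := Z\<rparr>\<^esub> m" using V.hom_nat_pow g(1) by blast
      also have "\<dots> = \<one>" using g(2) GZ.nat_pow_one[of m] by simp
      finally show ?thesis
        using torsion_free[of "g [^] m" "card I"] torsion_free[of g m] cardI m(1) g(1) by simp
    qed
    then show ?thesis using V.hom_one by (auto simp: kernel_def)
  qed
  then have inj: "inj_on V (carrier G)" using V.inj_iff_trivial_ker by blast
  show ?thesis
  proof (rule group_comm_groupI)
    fix x y assume xy: "x \<in> carrier G" "y \<in> carrier G"
    have "V (x \<otimes> y) = V (y \<otimes> x)"
      using xy V_mult Zcomm[OF V_Z[OF xy(1)], of "V y"] Zcarr V_Z by simp
    then show "x \<otimes> y = y \<otimes> x" using inj_onD[OF inj] xy by blast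
  qed
qed

text \<open>Let \<open>W\<close> be the centralizer of \<open>p\<close> and \<open>q\<close>, which has finite index, and \<open>H\<close> the centralizer of
\<open>W\<close>.  Then \<open>H\<close> contains \<open>p\<close> and \<open>q\<close>, and \<open>H \<inter> W\<close> is central in \<open>H\<close>, so \<open>H\<close> is central-by-finite.\<close>
lemma (in group) fc_center_commute:
  assumes tf: "torsion_free_group G" and pq: "p \<in> fc_center" "q \<in> fc_center"
  shows "p \<otimes> q = q \<otimes> p"
proof -
  define W where "W = centralizer {p, q}"
  define H where "H = centralizer W"
  have carr: "p \<in> carrier G" "q \<in> carrier G" using pq by (auto simp: fc_center_def)
  have Wsub: "subgroup W G" unfolding W_def by (rule subgroup_centralizer) (use carr in simp)
  have Hsub: "subgroup H G"
    unfolding H_def by (rule subgroup_centralizer[OF subgroup.subset[OF Wsub]])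
  have pqH: "p \<in> H" "q \<in> H" using carr by (auto simp: H_def W_def centralizer_def)
  interpret H: group "G\<lparr>carrier := H\<rparr>" by (rule subgroup_imp_group[OF Hsub])
  have center: "H.centralizer H = {u \<in> H. \<forall>h\<in>H. h \<otimes> u = u \<otimes> h}"
    by (simp add: H.centralizer_def)
  have Hcsub: "subgroup (H.centralizer H) (G\<lparr>carrier := H\<rparr>)"
    by (rule H.subgroup_centralizer) simp
  have "finite (rcosets W)" unfolding W_def by (rule finite_rcosets_centralizer) (use pq in auto)
  then have "finite ((\<lambda>u. W #> u) ` H)"
    using finite_subset[of "(\<lambda>u. W #> u) ` H" "rcosets W"] subgroup.subset[OF Hsub]
    by (auto simp: RCOSETS_def)
  then have "finite ((\<lambda>u. H.centralizer H #>\<^bsub>G\<lparr>carrier := H\<rparr>\<^esub> u) ` H)"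
  proof (rule finite_image_if_factors)
    fix u v assume uv: "u \<in> H" "v \<in> H" "W #> u = W #> v"
    then have uvG: "u \<in> carrier G" "v \<in> carrier G" using subgroup.mem_carrier[OF Hsub] by auto
    have W: "v \<otimes> inv u \<in> W" using rcos_eq_iff[OF Wsub uvG] uv(3) by blast
    have vuH: "v \<otimes> inv u \<in> H"
      using uv Hsub by (simp add: subgroup.m_closed subgroup.m_inv_closed)
    have "h \<otimes> (v \<otimes> inv u) = v \<otimes> inv u \<otimes> h" if "h \<in> H" for h
      using that W by (auto simp: H_def centralizer_def)
    with vuH have "v \<otimes> inv u \<in> H.centralizer H" by (simp add: center)
    then show "H.centralizer H #>\<^bsub>G\<lparr>carrier := H\<rparr>\<^esub> u = H.centralizer H #>\<^bsub>G\<lparr>carrier := H\<rparr>\<^esub> v"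
      using H.rcos_eq_iff[OF Hcsub] uv m_inv_consistent[OF Hsub] by simp
  qed
  then have "finite (rcosets\<^bsub>G\<lparr>carrier := H\<rparr>\<^esub> (H.centralizer (carrier (G\<lparr>carrier := H\<rparr>))))"
    by (simp add: RCOSETS_def UNION_singleton_eq_range)
  from H.torsion_free_center_by_finite_imp_comm[OF torsion_free_group_subgroup[OF tf Hsub] this]
  interpret H: comm_group "G\<lparr>carrier := H\<rparr>" .
  show ?thesis using H.m_comm[of p q] pqH by simp
qed

section \<open>Two-sided unique products\<close>

text \<open>\<open>M\<close> is the set of nonnegative elements for a partial order of the group in which each element of \<open>D\<close> is comparable with
\<open>1\<close>.  The signs are decided one element at a time: \<open>M\<close> can be enlarged by \<open>d\<close>
unless it contains the inverse of some \<open>d\<^sup>n\<close> with \<open>n > 0\<close>, and by \<open>d\<inverse>\<close> unless it contains some \<open>d\<^sup>k\<close>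
with \<open>k > 0\<close>.  If both fail, then \<open>d\<^bsup>nk\<^esup>\<close> and its inverse lie in \<open>M\<close>, so
\<open>d\<^bsup>nk\<^esup> = 1\<close> and \<open>d = 1\<close>.\<close>
lemma (in comm_group) ex_submonoid_deciding_signs:
  assumes tf: "torsion_free_group G" and "finite D" "D \<subseteq> carrier G"
  shows "\<exists>M. submonoid M G \<and> (\<forall>x\<in>M. inv x \<in> M \<longrightarrow> x = \<one>) \<and> (\<forall>d\<in>D. d \<in> M \<or> inv d \<in> M)"
  using assms(2,3)
proof (induction D rule: finite_induct)
  case empty
  have "submonoid {\<one>} G" by unfold_locales auto
  then show ?case by (intro exI[of _ "{\<one>}"]) auto
next
  case (insert d D)
  then obtain M where M: "submonoid M G" "\<And>x. x \<in> M \<Longrightarrow> inv x \<in> M \<Longrightarrow> x = \<one>"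
      "\<And>d. d \<in> D \<Longrightarrow> d \<in> M \<or> inv d \<in> M"
    by auto
  have d: "d \<in> carrier G" using insert.prems by simp
  have Mpow: "x [^] (n::nat) \<in> M" if "x \<in> M" for x n
    using that by (induction n) (auto intro: submonoid.m_closed[OF M(1)] submonoid.one_closed[OF M(1)])
  have torsion_free: "x = \<one>" if "x \<in> carrier G" "x [^] n = \<one>" "0 < n" for x and n :: nat
    using tf that by (auto simp: torsion_free_group_def)
  have extend: "\<exists>M'. submonoid M' G \<and> (\<forall>x\<in>M'. inv x \<in> M' \<longrightarrow> x = \<one>) \<and> M \<subseteq> M' \<and> d \<in> M'"
    if d: "d \<in> carrier G" and no: "\<And>n::nat. 0 < n \<Longrightarrow> inv (d [^] n) \<notin> M" for d
  proof -
    define M' where "M' = {d [^] n \<otimes> m | (n::nat) m. m \<in> M}"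
    have Mcarr: "m \<in> carrier G" if "m \<in> M" for m using that submonoid.subset[OF M(1)] by blast
    have prod: "(d [^] (n::nat) \<otimes> m) \<otimes> (d [^] (k::nat) \<otimes> m') = d [^] (n + k) \<otimes> (m \<otimes> m')"
      if "m \<in> M" "m' \<in> M" for n k m m'
      using that Mcarr d by (simp add: nat_pow_mult[symmetric] m_ac)
    have M'I: "d [^] (n::nat) \<otimes> m \<in> M'" if "m \<in> M" for n m using that by (auto simp: M'_def)
    have "submonoid M' G"
    proof
      show "M' \<subseteq> carrier G" using d Mcarr by (auto simp: M'_def)
      show "\<one> \<in> M'" using M'I[of \<one> 0] submonoid.one_closed[OF M(1)] by simp
      fix x y assume "x \<in> M'" "y \<in> M'"
      then show "x \<otimes> y \<in> M'"
        using prod M'I submonoid.m_closed[OF M(1)] by (auto simp: M'_def)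
    qed
    moreover have "x = \<one>" if x: "x \<in> M'" "inv x \<in> M'" for x
    proof -
      obtain n k :: nat and m m' where eq: "x = d [^] n \<otimes> m" "inv x = d [^] k \<otimes> m'" "m \<in> M" "m' \<in> M"
        using x by (auto simp: M'_def)
      have xc: "x \<in> carrier G" using eq Mcarr d by simp
      then have one: "d [^] (n + k) \<otimes> (m \<otimes> m') = \<one>" using prod[of m m' n k] eq by (metis r_inv)
      have mm': "m \<otimes> m' \<in> M" using eq submonoid.m_closed[OF M(1)] by blast
      then have "inv (d [^] (n + k)) = m \<otimes> m'"
        using one d Mcarr by (metis inv_equality m_comm nat_pow_closed)
      then have "n + k = 0" using no[of "n + k"] mm' by (cases "n + k = 0") simp_all
      then have "n = 0" "k = 0" by simp_all
      then have "m \<otimes> m' = \<one>" "x = m" using one eq Mcarr by simp_all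
      then have "inv m = m'" using eq Mcarr by (metis inv_equality m_comm)
      then show ?thesis using M(2)[of m] eq \<open>x = m\<close> by simp
    qed
    moreover have "M \<subseteq> M'" using M'I[of _ 0] Mcarr by fastforce
    moreover have "d \<in> M'" using M'I[of \<one> 1] submonoid.one_closed[OF M(1)] d by simp
    ultimately show ?thesis by blast
  qed
  have "\<exists>M'. submonoid M' G \<and> (\<forall>x\<in>M'. inv x \<in> M' \<longrightarrow> x = \<one>) \<and> M \<subseteq> M' \<and> (d \<in> M' \<or> inv d \<in> M')"
  proof (cases "\<exists>n::nat. 0 < n \<and> inv (d [^] n) \<in> M")
    case False
    then show ?thesis using extend[OF d] by blast
  next
    case True
    then obtain n :: nat where n: "0 < n" "inv (d [^] n) \<in> M" by blast
    show ?thesis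
    proof (cases "d = \<one>")
      case True
      then show ?thesis using M submonoid.one_closed[OF M(1)] by blast
    next
      case False
      have "inv (inv d [^] k) \<notin> M" if k: "0 < k" for k :: nat
      proof
        assume "inv (inv d [^] k) \<in> M"
        then have "d [^] k \<in> M" using d by (simp add: nat_pow_inv)
        then have "d [^] (k * n) \<in> M" using Mpow[of "d [^] k" n] d by (simp add: nat_pow_pow)
        moreover have "inv (d [^] (k * n)) \<in> M"
          using Mpow[OF n(2), of k] d by (simp add: nat_pow_inv nat_pow_pow mult.commute)
        ultimately have "d [^] (k * n) = \<one>" using M(2) by blast
        then show False using torsion_free[OF d, of "k * n"] False k n(1) by simp
      qed
      then show ?thesis using extend[of "inv d"] d by auto
    qed
  qed
  then show ?case using M(3) by (metis insert_iff subsetD)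
qed

text \<open>Fix a coset of the FC-centre \<open>\<Delta>\<close> meeting \<open>S\<close> and one meeting \<open>T\<close>; let \<open>s\<^sub>0\<close> and \<open>t\<^sub>0\<close> be maximal in
them for the partial order of \<open>\<Delta>\<close> given by a submonoid \<open>M\<close> that makes
the elements of \<open>S\<close> or \<open>T\<close> in each coset comparable.  The choice of \<open>u\<close> turns a coincidence \<open>s u t = s\<^sub>0 u t\<^sub>0\<close> into
\<open>s\<^sub>0\<inverse> s = t\<^sub>0 t\<inverse> \<in> \<Delta>\<close>.  By maximality the left side is at most \<open>1\<close> and the right side at least \<open>1\<close>.\<close>
lemma (in group) ex_two_sided_unique_product:
  assumes tf: "torsion_free_group G"
    and S: "finite S" "S \<noteq> {}" "S \<subseteq> carrier G" and T: "finite T" "T \<noteq> {}" "T \<subseteq> carrier G"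
  shows "\<exists>u\<in>carrier G. \<exists>s\<^sub>0\<in>S. \<exists>t\<^sub>0\<in>T. \<forall>s\<in>S. \<forall>t\<in>T. s \<otimes> u \<otimes> t = s\<^sub>0 \<otimes> u \<otimes> t\<^sub>0 \<longrightarrow> s = s\<^sub>0 \<and> t = t\<^sub>0"
proof -
  let ?\<Delta> = fc_center
  have \<Delta>G: "x \<in> carrier G" if "x \<in> ?\<Delta>" for x using that by (simp add: fc_center_def)
  note \<Delta>sub = subgroup_fc_center
  note SG = subsetD[OF S(3)] and TG = subsetD[OF T(3)]
  interpret \<Delta>: comm_group "G\<lparr>carrier := ?\<Delta>\<rparr>"
    by (rule group.group_comm_groupI[OF subgroup_imp_group[OF \<Delta>sub]])
       (simp add: fc_center_commute[OF tf])
  (* all quotients whose signs are needed to compare elements of one coset of the FC-centre *)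
  define D where "D = ((\<lambda>(s, s'). inv s \<otimes> s') ` (S \<times> S) \<union> (\<lambda>(t, t'). t \<otimes> inv t') ` (T \<times> T)) \<inter> ?\<Delta>"
  have D: "finite D" "D \<subseteq> ?\<Delta>" using S(1) T(1) by (auto simp: D_def)
  obtain M where M: "submonoid M (G\<lparr>carrier := ?\<Delta>\<rparr>)" "\<And>x. x \<in> M \<Longrightarrow> inv x \<in> M \<Longrightarrow> x = \<one>"
      "\<And>d. d \<in> D \<Longrightarrow> d \<in> M \<or> inv d \<in> M"
  proof -
    obtain M where M: "submonoid M (G\<lparr>carrier := ?\<Delta>\<rparr>)"
        "\<forall>x\<in>M. inv\<^bsub>G\<lparr>carrier := ?\<Delta>\<rparr>\<^esub> x \<in> M \<longrightarrow> x = \<one>"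
        "\<forall>d\<in>D. d \<in> M \<or> inv\<^bsub>G\<lparr>carrier := ?\<Delta>\<rparr>\<^esub> d \<in> M"
      using \<Delta>.ex_submonoid_deciding_signs[OF torsion_free_group_subgroup[OF tf \<Delta>sub] D(1)] D(2) by auto
    have "x \<in> ?\<Delta>" if "x \<in> M" for x using that submonoid.subset[OF M(1)] by auto
    then have "inv\<^bsub>G\<lparr>carrier := ?\<Delta>\<rparr>\<^esub> x = inv x" if "x \<in> M \<union> D" for x
      using m_inv_consistent[OF \<Delta>sub] that D(2) by blast
    then show thesis using M by (intro that[of M]) auto
  qed
  have M\<Delta>: "x \<in> ?\<Delta>" if "x \<in> M" for x using that submonoid.subset[OF M(1)] by auto
  have Mmult: "x \<otimes> y \<in> M" if "x \<in> M" "y \<in> M" for x y using that submonoid.m_closed[OF M(1)] by simp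
  obtain s\<^sub>1 t\<^sub>1 where s1: "s\<^sub>1 \<in> S" and t1: "t\<^sub>1 \<in> T" using S(2) T(2) by blast
  define S\<^sub>0 where "S\<^sub>0 = {s \<in> S. inv s\<^sub>1 \<otimes> s \<in> ?\<Delta>}"
  define T\<^sub>0 where "T\<^sub>0 = {t \<in> T. t \<otimes> inv t\<^sub>1 \<in> ?\<Delta>}"
  have S0: "s \<in> S" if "s \<in> S\<^sub>0" for s using that by (simp add: S\<^sub>0_def)
  have T0: "t \<in> T" if "t \<in> T\<^sub>0" for t using that by (simp add: T\<^sub>0_def)
  have cancelS: "(inv s \<otimes> s') \<otimes> (inv s' \<otimes> s'') = inv s \<otimes> s''" if "s \<in> S" "s' \<in> S" "s'' \<in> S" for s s' s''
  proof -
    have "s' \<otimes> (inv s' \<otimes> s'') = s''" using that SG by (simp add: m_assoc[symmetric])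
    then show ?thesis using that SG by (simp add: m_assoc)
  qed
  have cancelT: "(t \<otimes> inv t') \<otimes> (t' \<otimes> inv t'') = t \<otimes> inv t''" if "t \<in> T" "t' \<in> T" "t'' \<in> T" for t t' t''
  proof -
    have "inv t' \<otimes> (t' \<otimes> inv t'') = inv t''" using that TG by (simp add: m_assoc[symmetric])
    then show ?thesis using that TG by (simp add: m_assoc)
  qed
  have invS: "inv (inv s \<otimes> s') = inv s' \<otimes> s" if "s \<in> S" "s' \<in> S" for s s'
    using that SG by (simp add: inv_mult_group)
  have invT: "inv (t \<otimes> inv t') = t' \<otimes> inv t" if "t \<in> T" "t' \<in> T" for t t'
    using that TG by (simp add: inv_mult_group)
  have S0\<Delta>: "inv s \<otimes> s' \<in> ?\<Delta>" if "s \<in> S\<^sub>0" "s' \<in> S\<^sub>0" for s s'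
  proof -
    have "inv (inv s\<^sub>1 \<otimes> s) \<otimes> (inv s\<^sub>1 \<otimes> s') \<in> ?\<Delta>"
      using that subgroup.m_closed[OF \<Delta>sub] subgroup.m_inv_closed[OF \<Delta>sub] by (simp add: S\<^sub>0_def)
    then show ?thesis using cancelS[of s s\<^sub>1 s'] invS[of s\<^sub>1 s] s1 that S0 by simp
  qed
  have T0\<Delta>: "t \<otimes> inv t' \<in> ?\<Delta>" if "t \<in> T\<^sub>0" "t' \<in> T\<^sub>0" for t t'
  proof -
    have "(t \<otimes> inv t\<^sub>1) \<otimes> inv (t' \<otimes> inv t\<^sub>1) \<in> ?\<Delta>"
      using that subgroup.m_closed[OF \<Delta>sub] subgroup.m_inv_closed[OF \<Delta>sub] by (simp add: T\<^sub>0_def)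
    then show ?thesis using cancelT[of t t\<^sub>1 t'] invT[of t' t\<^sub>1] t1 that T0 by simp
  qed
  have "\<exists>m\<in>S\<^sub>0. \<forall>s\<in>S\<^sub>0. inv s \<otimes> m \<in> M"
  proof (rule finite_total_preorder_greatest)
    show "finite S\<^sub>0" using S(1) by (simp add: S\<^sub>0_def)
    show "S\<^sub>0 \<noteq> {}" using s1 SG subgroup.one_closed[OF \<Delta>sub] by (auto simp: S\<^sub>0_def)
    show "inv s \<otimes> s' \<in> M \<or> inv s' \<otimes> s \<in> M" if "s \<in> S\<^sub>0" "s' \<in> S\<^sub>0" for s s'
    proof -
      have "inv s \<otimes> s' \<in> D" using that S0 S0\<Delta> by (force simp: D_def)
      then show ?thesis using M(3)[of "inv s \<otimes> s'"] invS[of s s'] S0 that by simp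
    qed
    show "inv s \<otimes> s'' \<in> M" if "s \<in> S\<^sub>0" "s' \<in> S\<^sub>0" "s'' \<in> S\<^sub>0" "inv s \<otimes> s' \<in> M" "inv s' \<otimes> s'' \<in> M" for s s' s''
      using Mmult[OF that(4,5)] cancelS S0 that by simp
  qed
  then obtain s\<^sub>0 where s0: "s\<^sub>0 \<in> S\<^sub>0" "\<And>s. s \<in> S\<^sub>0 \<Longrightarrow> inv s \<otimes> s\<^sub>0 \<in> M" by blast
  have "\<exists>m\<in>T\<^sub>0. \<forall>t\<in>T\<^sub>0. m \<otimes> inv t \<in> M"
  proof (rule finite_total_preorder_greatest)
    show "finite T\<^sub>0" using T(1) by (simp add: T\<^sub>0_def)
    show "T\<^sub>0 \<noteq> {}" using t1 TG subgroup.one_closed[OF \<Delta>sub] by (auto simp: T\<^sub>0_def)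
    show "t' \<otimes> inv t \<in> M \<or> t \<otimes> inv t' \<in> M" if "t \<in> T\<^sub>0" "t' \<in> T\<^sub>0" for t t'
    proof -
      have "t' \<otimes> inv t \<in> D" using that T0 T0\<Delta> by (force simp: D_def)
      then show ?thesis using M(3)[of "t' \<otimes> inv t"] invT[of t' t] T0 that by simp
    qed
    show "t'' \<otimes> inv t \<in> M" if "t \<in> T\<^sub>0" "t' \<in> T\<^sub>0" "t'' \<in> T\<^sub>0" "t' \<otimes> inv t \<in> M" "t'' \<otimes> inv t' \<in> M" for t t' t''
      using Mmult[OF that(5,4)] cancelT T0 that by simp
  qed
  then obtain t\<^sub>0 where t0: "t\<^sub>0 \<in> T\<^sub>0" "\<And>t. t \<in> T\<^sub>0 \<Longrightarrow> t\<^sub>0 \<otimes> inv t \<in> M" by blast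
  have s0G: "s\<^sub>0 \<in> carrier G" and t0G: "t\<^sub>0 \<in> carrier G" using s0(1) t0(1) S0 T0 SG TG by auto
  (* u has to centralize D and to avoid finitely many cosets of subgroups of infinite index *)
  define W where "W = centralizer D"
  have DG: "D \<subseteq> carrier G" using D(2) \<Delta>G by blast
  have "\<exists>u\<in>W. \<forall>s\<in>S. \<forall>t\<in>T. inv s\<^sub>0 \<otimes> s \<notin> ?\<Delta> \<longrightarrow> inv u \<otimes> (inv s\<^sub>0 \<otimes> s) \<otimes> u \<noteq> t\<^sub>0 \<otimes> inv t"
    (is "\<exists>u\<in>W. ?good u")
  proof -
    have "finite (rcosets W)" unfolding W_def by (rule finite_rcosets_centralizer[OF D])
    then have "finite ((\<lambda>u. W #> u) ` carrier G)" by (simp add: RCOSETS_def UNION_singleton_eq_range)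
    from finite_subset_image[OF this subset_refl]
    obtain E where E: "finite E" "E \<subseteq> carrier G" "(\<lambda>u. W #> u) ` carrier G = (\<lambda>u. W #> u) ` E"
      by blast
    (* E represents the cosets of W.  If every u in W were bad, each x = u \<otimes> e with e in E would lie
       in the translate by e of one of the cosets that u has to avoid, and these would cover the group. *)
    define B where "B = (\<lambda>s. inv s\<^sub>0 \<otimes> s) ` S - ?\<Delta>"
    define \<K> where "\<K> = (\<lambda>p. centralizer {p}) ` B"
    define Q where "Q = (\<lambda>t. t\<^sub>0 \<otimes> inv t) ` T"
    have BG: "p \<in> carrier G" "p \<notin> ?\<Delta>" if "p \<in> B" for p using that s0G SG by (auto simp: B_def)
    have QG: "q \<in> carrier G" if "q \<in> Q" for q using that t0G TG by (auto simp: Q_def)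
    define v where "v p q = (SOME u. u \<in> carrier G \<and> inv u \<otimes> p \<otimes> u = q)" for p q
    define F where "F = (\<lambda>(p, q, e). v p q \<otimes> e) ` (B \<times> Q \<times> E) \<inter> carrier G"
    have v: "v p q \<in> carrier G" "u \<in> centralizer {p} #> v p q"
      if "p \<in> carrier G" "u \<in> carrier G" "inv u \<otimes> p \<otimes> u = q" for p q u
    proof -
      have v: "v p q \<in> carrier G \<and> inv (v p q) \<otimes> p \<otimes> v p q = q"
        unfolding v_def by (rule someI[of _ u]) (use that in simp)
      then show "v p q \<in> carrier G" by simp
      have "p \<otimes> (u \<otimes> inv (v p q)) = u \<otimes> inv (v p q) \<otimes> p"
        using conj_eq_conj_iff[of p "v p q" u] that v by simp
      then have "u \<otimes> inv (v p q) \<in> centralizer {p}" using that v by (auto simp: centralizer_def)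
      then have "centralizer {p} #> v p q = centralizer {p} #> u"
        using rcos_eq_iff[OF subgroup_centralizer, of "{p}" "v p q" u] that v by simp
      then show "u \<in> centralizer {p} #> v p q"
        using rcos_self[OF that(2) subgroup_centralizer[of "{p}"]] that(1) by simp
    qed
    have "\<exists>x\<in>carrier G. \<forall>K\<in>\<K>. \<forall>f\<in>F. x \<notin> K #> f"
    proof (rule neumann_coset_covering)
      show "finite \<K>" using S(1) by (simp add: \<K>_def B_def)
      show "subgroup K G \<and> infinite (rcosets K)" if "K \<in> \<K>" for K
        using that BG subgroup_centralizer infinite_rcosets_centralizer by (auto simp: \<K>_def)
      show "finite F" "F \<subseteq> carrier G" using S(1) T(1) E(1) by (auto simp: F_def B_def Q_def)
    qed
    then obtain x where x: "x \<in> carrier G" "\<And>K f. K \<in> \<K> \<Longrightarrow> f \<in> F \<Longrightarrow> x \<notin> K #> f" by blast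
    have Wsub: "subgroup W G" unfolding W_def by (rule subgroup_centralizer[OF DG])
    have "x \<in> W #> x" using rcos_self[OF x(1) Wsub] .
    moreover have "W #> x \<in> (\<lambda>u. W #> u) ` E" using E(3) x(1) by blast
    then obtain e where "e \<in> E" "W #> x = W #> e" by blast
    ultimately obtain e u where eu: "e \<in> E" "u \<in> W" "x = u \<otimes> e"
      unfolding r_coset_def by blast
    have uG: "u \<in> carrier G" and eG: "e \<in> carrier G"
      using eu E(2) subgroup.mem_carrier[OF Wsub] by auto
    have "?good u"
    proof (intro ballI impI notI)
      fix s t assume st: "s \<in> S" "t \<in> T" "inv s\<^sub>0 \<otimes> s \<notin> ?\<Delta>"
        and eq: "inv u \<otimes> (inv s\<^sub>0 \<otimes> s) \<otimes> u = t\<^sub>0 \<otimes> inv t"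
      let ?p = "inv s\<^sub>0 \<otimes> s" and ?q = "t\<^sub>0 \<otimes> inv t"
      have pq: "?p \<in> B" "?q \<in> Q" using st by (auto simp: B_def Q_def)
      note vv = v[OF BG(1)[OF pq(1)] uG eq]
      have "x \<in> centralizer {?p} #> (v ?p ?q \<otimes> e)"
      proof -
        obtain k where k: "k \<in> centralizer {?p}" "u = k \<otimes> v ?p ?q" using vv(2) by (auto simp: r_coset_def)
        have "x = k \<otimes> (v ?p ?q \<otimes> e)"
          using eu(3) k vv(1) eG by (simp add: centralizer_def m_assoc)
        then show ?thesis using k(1) by (auto simp: r_coset_def)
      qed
      moreover have "v ?p ?q \<otimes> e \<in> F" using pq eu(1) vv(1) eG by (force simp: F_def)
      ultimately show False using x(2) pq(1) by (auto simp: \<K>_def)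
    qed
    then show ?thesis using eu(2) by blast
  qed
  then obtain u where u: "u \<in> W" "?good u" by blast
  have uG: "u \<in> carrier G" using u(1) by (simp add: W_def centralizer_def)
  have "s = s\<^sub>0 \<and> t = t\<^sub>0" if st: "s \<in> S" "t \<in> T" and eq: "s \<otimes> u \<otimes> t = s\<^sub>0 \<otimes> u \<otimes> t\<^sub>0" for s t
  proof -
    note G = SG[OF st(1)] TG[OF st(2)] s0G t0G uG
    let ?p = "inv s\<^sub>0 \<otimes> s" and ?q = "t\<^sub>0 \<otimes> inv t"
    have "s \<otimes> u = s\<^sub>0 \<otimes> u \<otimes> t\<^sub>0 \<otimes> inv t"
      using inv_solve_right[of "s \<otimes> u" "s\<^sub>0 \<otimes> u \<otimes> t\<^sub>0" t] eq G by simp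
    also have "\<dots> = s\<^sub>0 \<otimes> (u \<otimes> ?q)" using G by (simp add: m_assoc)
    finally have "inv s\<^sub>0 \<otimes> (s \<otimes> u) = u \<otimes> ?q"
      using inv_solve_left'[of "u \<otimes> ?q" s\<^sub>0 "s \<otimes> u"] G by simp
    then have pu: "?p \<otimes> u = u \<otimes> ?q" using G by (simp add: m_assoc)
    then have conj: "inv u \<otimes> ?p \<otimes> u = ?q" using conj_eq_iff G by simp
    have p\<Delta>: "?p \<in> ?\<Delta>" using u(2) st conj by blast
    have s0S: "s\<^sub>0 \<in> S" and t0T: "t\<^sub>0 \<in> T" using s0(1) t0(1) S0 T0 by auto
    have "?p \<in> D" using p\<Delta> s0S st(1) by (force simp: D_def)
    then have "?p \<otimes> u = u \<otimes> ?p" using u(1) by (simp add: W_def centralizer_def)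
    then have pq: "?p = ?q" using pu G by simp
    have "s \<in> S\<^sub>0"
      using cancelS[OF s1 s0S st(1)] s0(1) p\<Delta> st(1) subgroup.m_closed[OF \<Delta>sub, of "inv s\<^sub>1 \<otimes> s\<^sub>0" ?p]
      by (simp add: S\<^sub>0_def)
    then have "inv ?p \<in> M" using s0(2) invS[OF s0S st(1)] by simp
    moreover have "t \<in> T\<^sub>0"
      using cancelT[OF st(2) t0T t1] t0(1) p\<Delta> pq st(2) invT[OF t0T st(2)]
        subgroup.m_closed[OF \<Delta>sub, of "t \<otimes> inv t\<^sub>0" "t\<^sub>0 \<otimes> inv t\<^sub>1"] subgroup.m_inv_closed[OF \<Delta>sub p\<Delta>]
      by (simp add: T\<^sub>0_def)
    then have "?p \<in> M" using t0(2) pq by simp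
    ultimately have p1: "?p = \<one>" using M(2) by blast
    then have q1: "?q = \<one>" using pq by simp
    have "s = s\<^sub>0 \<otimes> ?p" using G by (simp add: m_assoc[symmetric])
    moreover have "t\<^sub>0 = ?q \<otimes> t" using G by (simp add: m_assoc)
    ultimately show ?thesis using p1 q1 G by simp
  qed
  then show ?thesis using uG s0(1) t0(1) S0 T0 by blast
qed

section \<open>Homogeneous components\<close>

context graded_ring
begin

definition component :: "'r \<Rightarrow> 'g \<Rightarrow> 'r" where
  "component r = (THE f. f \<in> (\<Pi>\<^sub>E g\<in>carrier G. A g) \<and>
     finite {g \<in> carrier G. f g \<noteq> \<zero>} \<and> r = (\<Oplus>g\<in>{g \<in> carrier G. f g \<noteq> \<zero>}. f g))"

lemma component_carrier [simp]: "g \<in> carrier G \<Longrightarrow> r \<in> A g \<Longrightarrow> r \<in> carrier R"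
  using additive_subgroup.a_Hcarr[OF component_subgroup] by blast

lemma zero_in_component [simp]: "g \<in> carrier G \<Longrightarrow> \<zero> \<in> A g"
  using additive_subgroup.zero_closed[OF component_subgroup] by blast

lemma component_decomposition:
  assumes "r \<in> carrier R"
  shows "finite {g \<in> carrier G. component r g \<noteq> \<zero>}"
    and "r = (\<Oplus>g\<in>{g \<in> carrier G. component r g \<noteq> \<zero>}. component r g)"
    and "g \<in> carrier G \<Longrightarrow> component r g \<in> A g"
  using theI'[OF direct_sum[OF assms]] unfolding component_def[symmetric] by (auto simp: PiE_iff)

lemma component_of_sum:
  assumes F: "finite F" "F \<subseteq> carrier G" and f: "\<And>g. g \<in> F \<Longrightarrow> f g \<in> A g"
    and g: "g \<in> carrier G"
  shows "component (\<Oplus>h\<in>F. f h) g = (if g \<in> F then f g else \<zero>)"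
proof -
  let ?r = "\<Oplus>h\<in>F. f h"
  let ?f = "\<lambda>g\<in>carrier G. if g \<in> F then f g else \<zero>"
  let ?S = "{g \<in> carrier G. ?f g \<noteq> \<zero>}"
  have fR: "f \<in> F \<rightarrow> carrier R" using f F(2) by auto
  have r: "?r \<in> carrier R" using fR by (rule R.finsum_closed)
  have S: "?S \<subseteq> F" by auto
  have "(\<Oplus>h\<in>?S. ?f h) = ?r"
    by (rule R.add.finprod_mono_neutral_cong_left[OF F(1) S]) (use F(2) fR in auto)
  then have "?f \<in> (\<Pi>\<^sub>E g\<in>carrier G. A g) \<and> finite ?S \<and> ?r = (\<Oplus>h\<in>?S. ?f h)"
    using f finite_subset[OF S F(1)] by auto
  then have "component ?r = ?f"
    unfolding component_def by (rule the1_equality[OF direct_sum[OF r]])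
  then show ?thesis using g by simp
qed

lemma component_zero: "g \<in> carrier G \<Longrightarrow> component \<zero> g = \<zero>"
  using component_of_sum[of "{}" "\<lambda>_. \<zero>" g] by simp

lemma component_homogeneous:
  assumes "h \<in> carrier G" "r \<in> A h" "g \<in> carrier G"
  shows "component r g = (if g = h then r else \<zero>)"
  using component_of_sum[of "{h}" "\<lambda>_. r" g] assms by auto

lemma component_add:
  assumes r: "r \<in> carrier R" and s: "s \<in> carrier R" and g: "g \<in> carrier G"
  shows "component (r \<oplus> s) g = component r g \<oplus> component s g"
proof -
  let ?supp = "\<lambda>r. {g \<in> carrier G. component r g \<noteq> \<zero>}"
  define F where "F = ?supp r \<union> ?supp s"
  have F: "finite F" "F \<subseteq> carrier G"
    using component_decomposition(1) r s by (auto simp: F_def)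
  have expand: "x = (\<Oplus>g\<in>F. component x g)" if x: "x \<in> carrier R" "?supp x \<subseteq> F" for x
  proof -
    have "(\<Oplus>g\<in>?supp x. component x g) = (\<Oplus>g\<in>F. component x g)"
      by (rule R.add.finprod_mono_neutral_cong_left[OF F(1) x(2)])
         (use F(2) component_decomposition(3)[OF x(1)] in auto)
    then show ?thesis using component_decomposition(2)[OF x(1)] by simp
  qed
  have A: "component x h \<in> A h" "component x h \<in> carrier R" if "x \<in> carrier R" "h \<in> F" for x h
    using component_decomposition(3)[OF that(1)] that(2) F(2) by auto
  have "r \<oplus> s = (\<Oplus>g\<in>F. component r g) \<oplus> (\<Oplus>g\<in>F. component s g)"
    using expand[OF r] expand[OF s] by (auto simp: F_def)
  also have "\<dots> = (\<Oplus>g\<in>F. component r g \<oplus> component s g)"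
    using A r s by (intro R.finsum_addf[symmetric]) auto
  finally have "component (r \<oplus> s) g = (if g \<in> F then component r g \<oplus> component s g else \<zero>)"
    using component_of_sum[OF F, of "\<lambda>g. component r g \<oplus> component s g" g] A r s g F(2)
      additive_subgroup.a_closed[OF component_subgroup] by (simp add: subset_iff)
  then show ?thesis using g by (auto simp: F_def)
qed

lemma component_finsum:
  assumes "finite I" "f \<in> I \<rightarrow> carrier R" "g \<in> carrier G"
  shows "component (\<Oplus>i\<in>I. f i) g = (\<Oplus>i\<in>I. component (f i) g)"
  using assms
proof (induction I rule: finite_induct)
  case empty
  then show ?case by (simp add: component_zero)
next
  case (insert i I)
  have "component (f j) g \<in> carrier R" if "j \<in> insert i I" for j
    using component_decomposition(3)[of "f j" g] insert.prems that component_carrier by blast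
  then show ?case
    using insert by (simp add: R.finsum_insert component_add R.finsum_closed Pi_iff)
qed

end

section \<open>Non-degenerate gradings over a domain\<close>

locale nondegenerate_graded_ring = graded_ring +
  assumes nondegenerate: "nondegenerate_grading R G A"
    and identity_component_domain: "nc_domain (R\<lparr>carrier := A \<one>\<^bsub>G\<^esub>\<rparr>)"
begin

lemma identity_component_nonzero: "\<exists>a\<in>A \<one>\<^bsub>G\<^esub>. a \<noteq> \<zero>"
  using identity_component_domain zero_in_component[of "\<one>\<^bsub>G\<^esub>"] by (auto simp: nc_domain_def)

lemma identity_component_mult_nonzero:
  "\<lbrakk>a \<in> A \<one>\<^bsub>G\<^esub>; b \<in> A \<one>\<^bsub>G\<^esub>; a \<noteq> \<zero>; b \<noteq> \<zero>\<rbrakk> \<Longrightarrow> a \<otimes> b \<noteq> \<zero>"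
  using identity_component_domain by (auto simp: nc_domain_def)

text \<open>The zero product is always attained, so a product set different from \<open>{\<zero>}\<close> has a nonzero element.\<close>
lemma homogeneous_inverse_degree:
  assumes "g \<in> carrier G" "r \<in> A g" "r \<noteq> \<zero>"
  shows "\<exists>s\<in>A (inv\<^bsub>G\<^esub> g). r \<otimes> s \<noteq> \<zero>" and "\<exists>s\<in>A (inv\<^bsub>G\<^esub> g). s \<otimes> r \<noteq> \<zero>"
proof -
  have z: "\<zero> \<in> A (inv\<^bsub>G\<^esub> g)" using assms(1) by simp
  have "(\<lambda>s. r \<otimes> s) ` A (inv\<^bsub>G\<^esub> g) \<noteq> {\<zero>}" "(\<lambda>s. s \<otimes> r) ` A (inv\<^bsub>G\<^esub> g) \<noteq> {\<zero>}"
    using nondegenerate assms by (auto simp: nondegenerate_grading_def)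
  then show "\<exists>s\<in>A (inv\<^bsub>G\<^esub> g). r \<otimes> s \<noteq> \<zero>" "\<exists>s\<in>A (inv\<^bsub>G\<^esub> g). s \<otimes> r \<noteq> \<zero>"
    using z by auto
qed

text \<open>Multiplying \<open>r\<close> on the left and \<open>s\<close> on the right by elements of inverse degrees moves both into
the identity component, where nonzero factors have a nonzero product.\<close>
lemma homogeneous_mult_nonzero:
  assumes g: "g \<in> carrier G" "r \<in> A g" "r \<noteq> \<zero>" and h: "h \<in> carrier G" "s \<in> A h" "s \<noteq> \<zero>"
  shows "r \<otimes> s \<noteq> \<zero>"
proof
  assume rs: "r \<otimes> s = \<zero>"
  obtain a where a: "a \<in> A (inv\<^bsub>G\<^esub> g)" "a \<otimes> r \<noteq> \<zero>" using homogeneous_inverse_degree(2)[OF g] by blast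
  obtain b where b: "b \<in> A (inv\<^bsub>G\<^esub> h)" "s \<otimes> b \<noteq> \<zero>" using homogeneous_inverse_degree(1)[OF h] by blast
  have carr: "a \<in> carrier R" "r \<in> carrier R" "s \<in> carrier R" "b \<in> carrier R"
    using a b g h component_carrier G.inv_closed by blast+
  have "a \<otimes> r \<in> A \<one>\<^bsub>G\<^esub>" "s \<otimes> b \<in> A \<one>\<^bsub>G\<^esub>"
    using component_mult[of "inv\<^bsub>G\<^esub> g" g a r] component_mult[of h "inv\<^bsub>G\<^esub> h" s b] a b g h by simp_all
  then have "(a \<otimes> r) \<otimes> (s \<otimes> b) \<noteq> \<zero>" using identity_component_mult_nonzero a b by blast
  moreover have "(a \<otimes> r) \<otimes> (s \<otimes> b) = a \<otimes> ((r \<otimes> s) \<otimes> b)" using carr by (simp add: R.m_assoc)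
  ultimately show False using rs carr by simp
qed

lemma subgroup_support: "subgroup {g \<in> carrier G. \<exists>a\<in>A g. a \<noteq> \<zero>} G"
proof (rule G.subgroupI)
  show "{g \<in> carrier G. \<exists>a\<in>A g. a \<noteq> \<zero>} \<noteq> {}" using identity_component_nonzero by blast
  fix g assume "g \<in> {g \<in> carrier G. \<exists>a\<in>A g. a \<noteq> \<zero>}"
  then obtain a where a: "g \<in> carrier G" "a \<in> A g" "a \<noteq> \<zero>" by blast
  then obtain b where "b \<in> A (inv\<^bsub>G\<^esub> g)" "a \<otimes> b \<noteq> \<zero>" using homogeneous_inverse_degree(1) by blast
  moreover have "b \<noteq> \<zero>" using calculation(2) a by auto
  ultimately show "inv\<^bsub>G\<^esub> g \<in> {g \<in> carrier G. \<exists>a\<in>A g. a \<noteq> \<zero>}" using a(1) by blast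
next
  fix g h assume "g \<in> {g \<in> carrier G. \<exists>a\<in>A g. a \<noteq> \<zero>}" "h \<in> {g \<in> carrier G. \<exists>a\<in>A g. a \<noteq> \<zero>}"
  then show "g \<otimes>\<^bsub>G\<^esub> h \<in> {g \<in> carrier G. \<exists>a\<in>A g. a \<noteq> \<zero>}"
    using homogeneous_mult_nonzero component_mult by blast
qed auto

text \<open>The unique product is taken in the subgroup \<open>H\<close> of degrees with a nonzero component, so that a
nonzero \<open>a\<close> of the degree \<open>u\<close> exists.\<close>
lemma prime_if_torsion_free:
  assumes tf: "torsion_free_group G"
    and x: "x \<in> carrier R" "x \<noteq> \<zero>" and y: "y \<in> carrier R" "y \<noteq> \<zero>"
  shows "\<exists>a\<in>carrier R. x \<otimes> a \<otimes> y \<noteq> \<zero>"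
proof -
  define H where "H = {g \<in> carrier G. \<exists>a\<in>A g. a \<noteq> \<zero>}"
  have Hsub: "subgroup H G" unfolding H_def by (rule subgroup_support)
  have HG: "g \<in> carrier G" if "g \<in> H" for g using that by (simp add: H_def)
  let ?supp = "\<lambda>r. {g \<in> carrier G. component r g \<noteq> \<zero>}"
  have supp: "finite (?supp r)" "?supp r \<noteq> {}" "?supp r \<subseteq> H" if "r \<in> carrier R" "r \<noteq> \<zero>" for r
  proof -
    show "finite (?supp r)" by (rule component_decomposition(1)[OF that(1)])
    show "?supp r \<noteq> {}" using component_decomposition(2)[OF that(1)] that(2) by force
    show "?supp r \<subseteq> H" using component_decomposition(3)[OF that(1)] by (auto simp: H_def)
  qed
  define S where "S = ?supp x"
  define T where "T = ?supp y"
  note S = supp[OF x, folded S_def] and T = supp[OF y, folded T_def]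
  interpret H: group "G\<lparr>carrier := H\<rparr>" by (rule G.subgroup_imp_group[OF Hsub])
  obtain u s\<^sub>0 t\<^sub>0 where u: "u \<in> H" and s0: "s\<^sub>0 \<in> S" and t0: "t\<^sub>0 \<in> T"
    and unique: "\<And>s t. s \<in> S \<Longrightarrow> t \<in> T \<Longrightarrow> s \<otimes>\<^bsub>G\<^esub> u \<otimes>\<^bsub>G\<^esub> t = s\<^sub>0 \<otimes>\<^bsub>G\<^esub> u \<otimes>\<^bsub>G\<^esub> t\<^sub>0 \<Longrightarrow> s = s\<^sub>0 \<and> t = t\<^sub>0"
    using H.ex_two_sided_unique_product[OF torsion_free_group_subgroup[OF tf Hsub] S(1,2) _ T(1,2)] S(3) T(3)
    by auto
  obtain a where a: "a \<in> A u" "a \<noteq> \<zero>" using u by (auto simp: H_def)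
  have uG: "u \<in> carrier G" using u HG by blast
  have aR: "a \<in> carrier R" using a(1) uG by simp
  have SG: "s \<in> carrier G" "component x s \<in> A s" "component x s \<noteq> \<zero>" "component x s \<in> carrier R" if "s \<in> S" for s
    using that component_decomposition(3)[OF x(1)] component_carrier by (auto simp: S_def)
  have TG: "t \<in> carrier G" "component y t \<in> A t" "component y t \<noteq> \<zero>" "component y t \<in> carrier R" if "t \<in> T" for t
    using that component_decomposition(3)[OF y(1)] component_carrier by (auto simp: T_def)
  define m where "m s t = component x s \<otimes> a \<otimes> component y t" for s t
  have mA: "m s t \<in> A (s \<otimes>\<^bsub>G\<^esub> u \<otimes>\<^bsub>G\<^esub> t)" if "s \<in> S" "t \<in> T" for s t
    unfolding m_def using that SG TG uG a(1) by (intro component_mult) auto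
  have mR: "m s t \<in> carrier R" if "s \<in> S" "t \<in> T" for s t
    unfolding m_def using that SG TG aR by simp
  have "x \<otimes> a \<otimes> y = (\<Oplus>s\<in>S. component x s) \<otimes> a \<otimes> (\<Oplus>t\<in>T. component y t)"
    using component_decomposition(2)[OF x(1)] component_decomposition(2)[OF y(1)]
    by (simp add: S_def T_def)
  also have "\<dots> = (\<Oplus>s\<in>S. component x s \<otimes> a) \<otimes> (\<Oplus>t\<in>T. component y t)"
    using S(1) SG aR by (subst R.finsum_ldistr) auto
  also have "\<dots> = (\<Oplus>s\<in>S. component x s \<otimes> a \<otimes> (\<Oplus>t\<in>T. component y t))"
    using S(1) SG TG aR by (intro R.finsum_ldistr) (auto intro: R.finsum_closed)
  also have "\<dots> = (\<Oplus>s\<in>S. \<Oplus>t\<in>T. m s t)"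
    unfolding m_def using T(1) SG TG aR
    by (intro R.finsum_cong' R.finsum_rdistr) (auto intro!: R.finsum_closed)
  finally have expand: "x \<otimes> a \<otimes> y = (\<Oplus>s\<in>S. \<Oplus>t\<in>T. m s t)" .
  define v where "v = s\<^sub>0 \<otimes>\<^bsub>G\<^esub> u \<otimes>\<^bsub>G\<^esub> t\<^sub>0"
  have vG: "v \<in> carrier G" unfolding v_def using SG(1)[OF s0] TG(1)[OF t0] uG by simp
  have m_comp: "component (m s t) v = (if s\<^sub>0 = s \<and> t\<^sub>0 = t then m s t else \<zero>)" if "s \<in> S" "t \<in> T" for s t
    using component_homogeneous[OF _ mA[OF that] vG] unique[OF that] SG(1) TG(1) uG that
    by (auto simp: v_def)
  have "component (x \<otimes> a \<otimes> y) v = (\<Oplus>s\<in>S. component (\<Oplus>t\<in>T. m s t) v)"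
    unfolding expand using S(1) mR vG by (intro component_finsum) (auto intro!: R.finsum_closed)
  also have "\<dots> = (\<Oplus>s\<in>S. if s\<^sub>0 = s then m s t\<^sub>0 else \<zero>)"
  proof (rule R.finsum_cong'[OF refl])
    show "(\<lambda>s. if s\<^sub>0 = s then m s t\<^sub>0 else \<zero>) \<in> S \<rightarrow> carrier R" using mR t0 by auto
    fix s assume s: "s \<in> S"
    have "component (\<Oplus>t\<in>T. m s t) v = (\<Oplus>t\<in>T. component (m s t) v)"
      using T(1) mR s vG by (intro component_finsum) auto
    also have "\<dots> = (\<Oplus>t\<in>T. if t\<^sub>0 = t then (if s\<^sub>0 = s then m s t else \<zero>) else \<zero>)"
      using m_comp s mR by (intro R.finsum_cong') auto
    also have "\<dots> = (if s\<^sub>0 = s then m s t\<^sub>0 else \<zero>)"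
      using R.finsum_singleton[OF t0 T(1), of "\<lambda>t. if s\<^sub>0 = s then m s t else \<zero>"] mR s by auto
    finally show "component (\<Oplus>t\<in>T. m s t) v = (if s\<^sub>0 = s then m s t\<^sub>0 else \<zero>)" .
  qed
  also have "\<dots> = m s\<^sub>0 t\<^sub>0"
    using R.finsum_singleton[OF s0 S(1), of "\<lambda>s. m s t\<^sub>0"] mR t0 by auto
  also have "\<dots> \<noteq> \<zero>"
  proof -
    have "component x s\<^sub>0 \<otimes> a \<noteq> \<zero>"
      using homogeneous_mult_nonzero SG[OF s0] uG a by blast
    moreover have "component x s\<^sub>0 \<otimes> a \<in> A (s\<^sub>0 \<otimes>\<^bsub>G\<^esub> u)"
      using component_mult SG[OF s0] uG a by blast
    ultimately show ?thesis
      unfolding m_def using homogeneous_mult_nonzero[of "s\<^sub>0 \<otimes>\<^bsub>G\<^esub> u"] SG[OF s0] TG[OF t0] uG by simp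
  qed
  finally have "x \<otimes> a \<otimes> y \<noteq> \<zero>" using component_zero[OF vG] by auto
  then show ?thesis using aR by blast
qed

end

section \<open>Units, zero divisors and idempotents\<close>

text \<open>If \<open>x\<^sup>n = 0\<close> with \<open>n \<ge> 2\<close>, then \<open>x\<^bsup>n-1\<^esup>\<close> has square zero, because \<open>2 (n - 1) \<ge> n\<close>, and the exponent drops.\<close>
lemma (in ring) reduced_ring_if_no_square_zero:
  assumes sq: "\<And>x. x \<in> carrier R \<Longrightarrow> x \<otimes> x = \<zero> \<Longrightarrow> x = \<zero>"
  shows "reduced_ring R"
  unfolding reduced_ring_def
proof (intro ballI allI impI)
  fix x and n :: nat
  assume x: "x \<in> carrier R" and "0 < n" "x [^] n = \<zero>"
  then show "x = \<zero>"
  proof (induction n rule: less_induct)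
    case (less n)
    show ?case
    proof (cases "n = 1")
      case True
      then show ?thesis using less.prems by simp
    next
      case False
      then have n: "0 < n - 1" "n \<le> (n - 1) + (n - 1)" using less.prems(2) by auto
      then obtain k where "(n - 1) + (n - 1) = n + k" using le_Suc_ex by blast
      then have "x [^] (n - 1) \<otimes> x [^] (n - 1) = x [^] n \<otimes> x [^] k"
        using x by (simp add: nat_pow_mult)
      also have "\<dots> = \<zero>" using x less.prems(3) by simp
      finally have "x [^] (n - 1) = \<zero>" by (rule sq[OF nat_pow_closed[OF x]])
      then show ?thesis using less.IH[of "n - 1"] n(1) x by simp
    qed
  qed
qed

context nondegenerate_graded_ring
begin

text \<open>The hypothesis is applied to the two units \<open>1\<close> and \<open>1 + x\<close>, where \<open>x\<^sup>2 = 0\<close> and the inverse of \<open>1 + x\<close> is \<open>1 - x\<close>.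
For \<open>1\<close> it gives a degree \<open>k\<close> with \<open>k\<^sup>2 = k\<close>, that is, \<open>1\<close> has degree \<open>e\<close>.\<close>
lemma reduced_if_units_homogeneous:
  assumes tf: "torsion_free_group G" and hom: "\<forall>u\<in>Units R. homogeneous R G A u"
  shows "reduced_ring R"
proof (rule R.reduced_ring_if_no_square_zero)
  fix x assume x: "x \<in> carrier R" "x \<otimes> x = \<zero>"
  let ?e = "\<one>\<^bsub>G\<^esub>"
  have torsion_free: "h = ?e" if "h \<in> carrier G" "h \<otimes>\<^bsub>G\<^esub> h = ?e" for h
  proof -
    have "h [^]\<^bsub>G\<^esub> (2::nat) = ?e" using that by (simp add: numeral_2_eq_2)
    then show ?thesis using tf that(1) unfolding torsion_free_group_def by (metis pos2)
  qed
  have one_nz: "\<one> \<noteq> \<zero>" and one_A: "\<one> \<in> A ?e"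
  proof -
    obtain k where k: "\<one> \<noteq> \<zero>" "k \<in> carrier G" "\<one> \<in> A k"
      using hom R.Units_one_closed by (auto simp: homogeneous_def)
    have "\<one> \<in> A (k \<otimes>\<^bsub>G\<^esub> k)" using component_mult[OF k(2,2) k(3,3)] by simp
    then have "k \<otimes>\<^bsub>G\<^esub> k = k"
      using component_homogeneous[OF k(2,3), of "k \<otimes>\<^bsub>G\<^esub> k"]
        component_homogeneous[of "k \<otimes>\<^bsub>G\<^esub> k" \<one> "k \<otimes>\<^bsub>G\<^esub> k"] k by (auto split: if_splits)
    then have "k = ?e" using k(2) G.l_cancel_one' by simp
    then show "\<one> \<noteq> \<zero>" "\<one> \<in> A ?e" using k by auto
  qed
  define r where "r = \<one> \<oplus> x"
  have "r \<in> Units R"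
  proof -
    have "(\<one> \<oplus> x) \<otimes> (\<one> \<ominus> x) = \<one>" "(\<one> \<ominus> x) \<otimes> (\<one> \<oplus> x) = \<one>"
      using x by (simp_all add: R.minus_eq R.l_distr R.r_distr R.r_minus R.l_minus R.a_assoc R.r_neg R.l_neg)
    then show ?thesis unfolding Units_def r_def using x by auto
  qed
  then obtain g where g: "g \<in> carrier G" "r \<in> A g" using hom by (auto simp: homogeneous_def)
  have rR: "r \<in> carrier R" using g by simp
  have xr: "x = r \<ominus> \<one>" unfolding r_def using x(1) by (simp add: R.minus_eq R.a_assoc R.a_comm[of \<one>] R.r_neg)
  show "x = \<zero>"
  proof (cases "g = ?e")
    case True
    then have "x \<in> A ?e"
      unfolding xr R.minus_eq using g(2) one_A
        additive_subgroup.a_closed[OF component_subgroup[of ?e]]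
        additive_subgroup.a_inv_closed[OF component_subgroup[of ?e]] by simp
    then show ?thesis using identity_component_mult_nonzero x(2) by blast
  next
    case False
    (* x\<^sup>2 = 0 written in terms of r; the left side has degree-e component 1, the right side none *)
    have sum: "\<one> \<oplus> r \<otimes> r = r \<oplus> r"
      unfolding r_def using x by (simp add: R.l_distr R.r_distr R.a_ac)
    have gg: "g \<otimes>\<^bsub>G\<^esub> g \<in> carrier G" "r \<otimes> r \<in> A (g \<otimes>\<^bsub>G\<^esub> g)" "?e \<noteq> g \<otimes>\<^bsub>G\<^esub> g"
      using g component_mult[OF g(1,1) g(2,2)] torsion_free[OF g(1)] False by (simp, simp, metis)
    have "component (\<one> \<oplus> r \<otimes> r) ?e = \<one>"
      using component_add[of \<one> "r \<otimes> r" ?e] component_homogeneous[OF _ one_A, of ?e]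
        component_homogeneous[OF gg(1,2), of ?e] gg(3) rR by simp
    moreover have "component (r \<oplus> r) ?e = \<zero>"
      using component_add[of r r ?e] component_homogeneous[OF g, of ?e] False rR by auto
    ultimately show ?thesis using sum one_nz by simp
  qed
qed

text \<open>In a reduced ring \<open>x y = 0\<close> forces \<open>x a y = 0\<close> for every \<open>a\<close>, so primeness leaves no zero divisors.\<close>
lemma domain_if_reduced:
  assumes tf: "torsion_free_group G" and red: "reduced_ring R"
  shows "nc_domain R"
  unfolding nc_domain_def
proof (intro conjI ballI impI notI)
  assume "carrier R = {\<zero>}"
  then show False using identity_component_nonzero component_carrier[of "\<one>\<^bsub>G\<^esub>"] by auto
next
  fix x y assume xy: "x \<in> carrier R" "y \<in> carrier R" "x \<noteq> \<zero>" "y \<noteq> \<zero>" "x \<otimes> y = \<zero>"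
  have sq: "z = \<zero>" if "z \<in> carrier R" "z \<otimes> z = \<zero>" for z
  proof -
    have "z [^] (2::nat) = \<zero>" using that by (simp add: numeral_2_eq_2)
    then show ?thesis using red that(1) unfolding reduced_ring_def by (metis pos2)
  qed
  have "(y \<otimes> x) \<otimes> (y \<otimes> x) = y \<otimes> ((x \<otimes> y) \<otimes> x)" using xy(1,2) by (simp add: R.m_assoc)
  also have "\<dots> = \<zero>" using xy by simp
  finally have yx: "y \<otimes> x = \<zero>" using sq[of "y \<otimes> x"] xy by simp
  obtain a where a: "a \<in> carrier R" "x \<otimes> a \<otimes> y \<noteq> \<zero>"
    using prime_if_torsion_free[OF tf] xy by blast
  have "(x \<otimes> a \<otimes> y) \<otimes> (x \<otimes> a \<otimes> y) = x \<otimes> a \<otimes> ((y \<otimes> x) \<otimes> (a \<otimes> y))"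
    using xy(1,2) a(1) by (simp add: R.m_assoc)
  also have "\<dots> = \<zero>" using yx xy a(1) by simp
  finally show False using sq[of "x \<otimes> a \<otimes> y"] a xy by simp
qed

end

lemma (in ring) only_trivial_idempotents_if_domain:
  assumes "nc_domain R"
  shows "only_trivial_idempotents R"
  unfolding only_trivial_idempotents_def
proof (intro ballI impI)
  fix x assume x: "x \<in> carrier R" "x \<otimes> x = x"
  then have "x \<otimes> (x \<ominus> \<one>) = \<zero>" by (simp add: minus_eq r_distr r_minus r_neg)
  then have "x = \<zero> \<or> x \<ominus> \<one> = \<zero>" using assms x(1) by (auto simp: nc_domain_def)
  then show "x = \<zero> \<or> x = \<one>" using x(1) by auto
qed

lemma (in ring) reduced_ring_if_domain:
  assumes "nc_domain R"
  shows "reduced_ring R"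
  using assms by (intro reduced_ring_if_no_square_zero) (auto simp: nc_domain_def)

theorem theorem5p2:
  fixes R :: "('r, 'n) ring_scheme"
    and G :: "('g, 'm) monoid_scheme"
    and A :: "'g \<Rightarrow> 'r set"
  assumes "torsion_free_group G"
    and "graded_ring R G A"
    and "nondegenerate_grading R G A"
    and "nc_domain (R\<lparr>carrier := A \<one>\<^bsub>G\<^esub>\<rparr>)"
  shows "((\<forall>u\<in>Units R. homogeneous R G A u) \<longrightarrow> reduced_ring R) \<and>
         (reduced_ring R \<longrightarrow> nc_domain R) \<and>
         (nc_domain R \<longrightarrow> only_trivial_idempotents R) \<and>
         (nc_domain R \<longrightarrow> reduced_ring R)"
proof -
  interpret nondegenerate_graded_ring R G A
    using assms(2-4) by (simp add: nondegenerate_graded_ring_def nondegenerate_graded_ring_axioms_def)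
  show ?thesis
    using reduced_if_units_homogeneous[OF assms(1)] domain_if_reduced[OF assms(1)]
      R.only_trivial_idempotents_if_domain R.reduced_ring_if_domain by blast
qed

end
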